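(* Consider term structures $P^{(t)}(T)$, $t,T\in\mathbf{Z}_+$, on the $\mathbf{R}^{n+1}$-valued state process $i_t=(t,\mathbf{w}_t)$ described in the context, satisfying (a1), (a2') and (a3). (i) There exist a constant vector $\sigma\in\mathbf{R}^n$ and a function $\mu:\mathbf{Z}_+\to\mathbf{R}$ such that the dynamics of the entire term structure is given, in terms of the initial term structure $P^{(0)}(\cdot)$, $\sigma$ and $\mu$, by $$P^{(t)}(T)=\frac{P^{(0)}(t+T)}{P^{(0)}(t)}\exp\Big\{-T\langle\sigma,\mathbf{w}_t-\mathbf{w}_0\rangle-\sum_{u=0}^{T-1}\sum_{v=1}^{t}\mu(u+v-1)\Big\},\qquad t,T\in\mathbf{Z}_+ .$$ (ii) The no-arbitrage condition (a4') is equivalent to the following drift condition: there is a probability $\pi$ on $S$ with $\pi(s)\in(0,1)$ for all $s\in S$ such that, for all $T\in\mathbf{Z}_+$, $$\mu(T)=\log\frac{\sum_{s\in S}\pi(s)e^{-(T+1)\langle\sigma,\Delta\mathbf{w}(s)\rangle}}{\sum_{s\in S}\pi(s)e^{-T\langle\sigma,\Delta\mathbf{w}(s)\rangle}} .$$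
   Context: $\mathbf{Z}_+=\{0,1,2,\dots\}$, $n\ge1$, and the time unit is $\Delta t=1$. $P^{(t)}(T)$ denotes the price at time $t$ of the zero-coupon bond whose time to maturity is $T$; it is strictly positive, with $P^{(t)}(0)=1$, and $P^{(0)}(\cdot)$ is deterministic. Let $S=\{0,1,\dots,n\}$. (a2') $\Delta\mathbf{w}=(\Delta w^1,\dots,\Delta w^n)$ is a random variable defined on $S$ (each point of $S$ having positive probability), taking $n+1$ distinct values $\Delta\mathbf{w}(s)$, $s\in S$, with $\mathbf{E}[\Delta w^j]=0$ and $\mathrm{Cov}(\Delta w^i,\Delta w^j)=1$ if $i=j$, $0$ otherwise. $\Delta\mathbf{w}_1,\Delta\mathbf{w}_2,\dots$ are independent copies of $\Delta\mathbf{w}$, $\mathbf{w}_t=\mathbf{w}_0+\sum_{u=1}^t\Delta\mathbf{w}_u$ with $\mathbf{w}_0$ constant, and the state variable is $i_t=(t,\mathbf{w}_t)\in\mathbf{R}^{n+1}$, so $\Delta i_t:=i_t-i_{t-1}=(1,\Delta\mathbf{w}_t)$. Write $\Delta i(s)=(1,\Delta\mathbf{w}(s))$. (a1) For each $t$ and $T$, the random variable $P^{(t)}(T)$ depends only on the state $i_t$; write $P^{(t)}_i(T)$ for its value when $i_t=i$. (a3) (stationarity) For $t\ge1$ and $T\ge0$, the quantity $P^{(t)}_{i_t}(T)\,P^{(t-1)}_{i_{t-1}}(1)\,/\,P^{(t-1)}_{i_{t-1}}(T+1)$ depends only on $T$ and $\Delta i_t$. (a4') For every reachable state $i=(t,w)$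 there is a probability $\pi_i(\cdot)\in(0,1)$ on $S$ such that for all integers $T>0$, $P_i^{(t)}(T+1)=P_i^{(t)}(1)\sum_{s\in S}\pi_i(s)\,P^{(t+1)}_{i+\Delta i(s)}(T)$. *)

theory Defs
  imports "HOL-Probability.Probability"
begin

definition covariance :: "'a measure \<Rightarrow> ('a \<Rightarrow> real) \<Rightarrow> ('a \<Rightarrow> real) \<Rightarrow> real" where
  "covariance M X Y =
     (\<integral>x. (X x - (\<integral>y. X y \<partial>M)) * (Y x - (\<integral>y. Y y \<partial>M)) \<partial>M)"

text \<open>The dimension \<open>n\<close> is \<open>CARD('n)\<close>, so \<open>S = {0..CARD('n)}\<close> has \<open>n + 1\<close> points;
  \<open>p\<close> is the law on \<open>S\<close> and \<open>D s\<close> is the value of the increment at the point \<open>s\<close>.\<close>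

definition standard_increment :: "nat pmf \<Rightarrow> (nat \<Rightarrow> real ^ 'n) \<Rightarrow> bool" where
  "standard_increment p D \<longleftrightarrow>
     set_pmf p = {0..CARD('n)} \<and>
     inj_on D {0..CARD('n)} \<and>
     (\<forall>j. measure_pmf.expectation p (\<lambda>s. D s $ j) = 0) \<and>
     (\<forall>i j. covariance (measure_pmf p) (\<lambda>s. D s $ i) (\<lambda>s. D s $ j) = (if i = j then 1 else 0))"

definition independent_copies ::
  "'a measure \<Rightarrow> nat pmf \<Rightarrow> (nat \<Rightarrow> real ^ 'n) \<Rightarrow> (nat \<Rightarrow> 'a \<Rightarrow> real ^ 'n) \<Rightarrow> bool" where
  "independent_copies M p D dw \<longleftrightarrow>
     prob_space.indep_vars M (\<lambda>_. borel) dw {1..} \<and>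
     (\<forall>u\<ge>1. distr M borel (dw u) = distr (measure_pmf p) borel D)"

definition walk :: "real ^ 'n \<Rightarrow> (nat \<Rightarrow> 'a \<Rightarrow> real ^ 'n) \<Rightarrow> nat \<Rightarrow> 'a \<Rightarrow> real ^ 'n" where
  "walk w0 dw t \<omega> = w0 + (\<Sum>u=1..t. dw u \<omega>)"

definition state :: "real ^ 'n \<Rightarrow> (nat \<Rightarrow> 'a \<Rightarrow> real ^ 'n) \<Rightarrow> nat \<Rightarrow> 'a \<Rightarrow> real \<times> (real ^ 'n)" where
  "state w0 dw t \<omega> = (real t, walk w0 dw t \<omega>)"

definition reachable ::
  "'a measure \<Rightarrow> (nat \<Rightarrow> 'a \<Rightarrow> real \<times> (real ^ 'n)) \<Rightarrow> nat \<Rightarrow> real \<times> (real ^ 'n) \<Rightarrow> bool" where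
  "reachable M X t i \<longleftrightarrow> 0 < measure M {\<omega> \<in> space M. X t \<omega> = i}"

text \<open>\<open>P t T\<close> is the price at time \<open>t\<close> of the bond with time \<^emph>\<open>to\<close> maturity \<open>T\<close>. The copies of
  the increment take their values in the range of \<open>D\<close> only almost surely, so all relations
  between random variables are meant almost surely.\<close>

definition term_structure :: "'a measure \<Rightarrow> (nat \<Rightarrow> nat \<Rightarrow> 'a \<Rightarrow> real) \<Rightarrow> bool" where
  "term_structure M P \<longleftrightarrow>
     (\<forall>t T. P t T \<in> borel_measurable M) \<and>
     (\<forall>t T. AE \<omega> in M. 0 < P t T \<omega>) \<and>
     (\<forall>t. AE \<omega> in M. P t 0 \<omega> = 1) \<and>
     (\<forall>T. \<exists>c. AE \<omega> in M. P 0 T \<omega> = c)"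

text \<open>\<open>V t T i\<close> is the value of \<open>P t T\<close> in the state \<open>i\<close>; it is determined by \<open>P\<close> at the states
  \<open>i\<close> reachable at time \<open>t\<close>, and arbitrary elsewhere.\<close>

definition state_dependent ::
  "'a measure \<Rightarrow> (nat \<Rightarrow> 'a \<Rightarrow> real \<times> (real ^ 'n)) \<Rightarrow> (nat \<Rightarrow> nat \<Rightarrow> 'a \<Rightarrow> real) \<Rightarrow>
   (nat \<Rightarrow> nat \<Rightarrow> real \<times> (real ^ 'n) \<Rightarrow> real) \<Rightarrow> bool" where
  "state_dependent M X P V \<longleftrightarrow> (\<forall>t T. AE \<omega> in M. P t T \<omega> = V t T (X t \<omega>))"

definition stationary ::
  "'a measure \<Rightarrow> (nat \<Rightarrow> 'a \<Rightarrow> real \<times> (real ^ 'n)) \<Rightarrow> (nat \<Rightarrow> nat \<Rightarrow> 'a \<Rightarrow> real) \<Rightarrow> bool" where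
  "stationary M X P \<longleftrightarrow>
     (\<exists>h :: nat \<Rightarrow> real \<times> (real ^ 'n) \<Rightarrow> real. \<forall>t\<ge>1. \<forall>T. AE \<omega> in M.
        P t T \<omega> * P (t - 1) 1 \<omega> / P (t - 1) (T + 1) \<omega> = h T (X t \<omega> - X (t - 1) \<omega>))"

definition positive_prob :: "nat set \<Rightarrow> (nat \<Rightarrow> real) \<Rightarrow> bool" where
  "positive_prob S q \<longleftrightarrow> (\<forall>s\<in>S. 0 < q s \<and> q s < 1) \<and> (\<Sum>s\<in>S. q s) = 1"

definition no_arbitrage ::
  "'a measure \<Rightarrow> (nat \<Rightarrow> real ^ 'n) \<Rightarrow> (nat \<Rightarrow> 'a \<Rightarrow> real \<times> (real ^ 'n)) \<Rightarrow>
   (nat \<Rightarrow> nat \<Rightarrow> real \<times> (real ^ 'n) \<Rightarrow> real) \<Rightarrow> bool" where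
  "no_arbitrage M D X V \<longleftrightarrow>
     (\<forall>t i. reachable M X t i \<longrightarrow>
        (\<exists>q. positive_prob {0..CARD('n)} q \<and>
          (\<forall>T>0. V t (T + 1) i =
             V t 1 i * (\<Sum>s\<in>{0..CARD('n)}. q s * V (t + 1) T (i + (1, D s))))))"

definition dynamics ::
  "'a measure \<Rightarrow> real ^ 'n \<Rightarrow> (nat \<Rightarrow> 'a \<Rightarrow> real ^ 'n) \<Rightarrow> (nat \<Rightarrow> nat \<Rightarrow> 'a \<Rightarrow> real) \<Rightarrow>
   real ^ 'n \<Rightarrow> (nat \<Rightarrow> real) \<Rightarrow> bool" where
  "dynamics M w0 dw P \<sigma> \<mu> \<longleftrightarrow>
     (\<forall>t T. AE \<omega> in M.
        P t T \<omega> = P 0 (t + T) \<omega> / P 0 t \<omega> *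
          exp (- real T * (\<sigma> \<bullet> (walk w0 dw t \<omega> - w0)) - (\<Sum>u<T. \<Sum>v=1..t. \<mu> (u + v - 1))))"

definition drift_condition :: "(nat \<Rightarrow> real ^ 'n) \<Rightarrow> real ^ 'n \<Rightarrow> (nat \<Rightarrow> real) \<Rightarrow> bool" where
  "drift_condition D \<sigma> \<mu> \<longleftrightarrow>
     (\<exists>q. positive_prob {0..CARD('n)} q \<and>
       (\<forall>T. \<mu> T =
          ln ((\<Sum>s\<in>{0..CARD('n)}. q s * exp (- real (T + 1) * (\<sigma> \<bullet> D s))) /
              (\<Sum>s\<in>{0..CARD('n)}. q s * exp (- real T * (\<sigma> \<bullet> D s))))))"

end

theory Submission
  imports Defs
begin

text \<open>Every path of increments with values in \<open>D ` S\<close> has positive probability up to any time, so an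
  almost sure relation between the walk and its next increment is the same as a pointwise relation
  on the lattice of points that such paths reach. Everything then takes place on that lattice.

  Let \<open>l t T w\<close> be the logarithm of the price at the lattice point \<open>w\<close>. Stationarity says that
  \<open>l (t + 1) T (w + D s) = g T s + l t (T + 1) w - l t 1 w\<close> for some function \<open>g\<close>. Two increments
  \<open>s\<close>, \<open>s'\<close> lead to the same state in either order, and comparing the two resulting prices shows
  that \<open>g (T + 1) s - g T s - g 1 s\<close> is the same for all \<open>s\<close>; hence \<open>g T s\<close> is
  \<open>T * g 1 s\<close> up to a function of \<open>T\<close> alone. The \<open>n + 1\<close> points \<open>D s\<close> are affinely independent,
  because their covariance matrix is the identity, so \<open>g 1\<close> is an affine function of \<open>D s\<close>. This
  gives \<open>g T s = - T * (\<sigma> \<bullet> D s) - (\<Sum>u<T. \<mu> u)\<close> (\<open>exchangeable_step_affine\<close>), and induction on \<open>t\<close>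
  gives the dynamics (\<open>log_price_solution\<close>).

  For the drift condition, insert the dynamics into the pricing equation at a lattice point. All
  factors that involve the state, the time and the initial term structure cancel, and what is left
  is \<open>exp (\<Sum>u<T. \<mu> u) = (\<Sum>s. q s * exp (- T * (\<sigma> \<bullet> D s)))\<close> (\<open>one_step_pricing_iff\<close>). This does not
  mention the state, so the probability found at the initial state serves at all states, and taking
  quotients of consecutive equations turns it into the formula for \<open>\<mu>\<close>
  (\<open>drift_condition_iff_exponential\<close>).\<close>

section \<open>Affine interpolation at the increments\<close>

lemma standard_increment_moments:
  fixes D :: "nat \<Rightarrow> real ^ 'n"
  assumes "standard_increment p D"
  shows "(\<Sum>s\<in>{0..CARD('n)}. pmf p s * D s $ j) = 0"
    and "(\<Sum>s\<in>{0..CARD('n)}. pmf p s * (D s $ i * D s $ j)) = (if i = j then 1 else 0)"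
    and "(\<Sum>s\<in>{0..CARD('n)}. pmf p s) = 1"
proof -
  have supp: "set_pmf p = {0..CARD('n)}"
    and mean: "\<And>j. measure_pmf.expectation p (\<lambda>s. D s $ j) = 0"
    and cov: "covariance (measure_pmf p) (\<lambda>s. D s $ i) (\<lambda>s. D s $ j) = (if i = j then 1 else 0)"
    using assms unfolding standard_increment_def by auto
  have E: "measure_pmf.expectation p f = (\<Sum>s\<in>{0..CARD('n)}. pmf p s * f s)"
    for f :: "nat \<Rightarrow> real"
    using supp by (subst integral_measure_pmf[of "{0..CARD('n)}"]) auto
  show "(\<Sum>s\<in>{0..CARD('n)}. pmf p s * D s $ j) = 0"
    using mean[of j] unfolding E .
  show "(\<Sum>s\<in>{0..CARD('n)}. pmf p s * (D s $ i * D s $ j)) = (if i = j then 1 else 0)"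
    using cov unfolding covariance_def mean E by simp
  show "(\<Sum>s\<in>{0..CARD('n)}. pmf p s) = 1"
    using sum_pmf_eq_1[of "{0..CARD('n)}" p] supp by simp
qed

text \<open>The mean of \<open>c + \<sigma> \<bullet> D s\<close> is \<open>c\<close>, and its covariance with the coordinate \<open>D s $ i\<close> is \<open>\<sigma> $ i\<close>.\<close>

lemma affine_vanishing_on_increments:
  fixes D :: "nat \<Rightarrow> real ^ 'n"
  assumes std: "standard_increment p D"
    and zero: "\<And>s. s \<in> {0..CARD('n)} \<Longrightarrow> c + \<sigma> \<bullet> D s = 0"
  shows "c = 0" and "\<sigma> = 0"
proof -
  note moments = standard_increment_moments[OF std]
  let ?S = "{0..CARD('n)}"
  have "0 = (\<Sum>s\<in>?S. pmf p s * (c + \<sigma> \<bullet> D s))"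
    using zero by simp
  also have "\<dots> = (\<Sum>s\<in>?S. pmf p s) * c + (\<Sum>s\<in>?S. \<Sum>j\<in>UNIV. \<sigma> $ j * (pmf p s * D s $ j))"
    by (simp add: inner_vec_def algebra_simps sum.distrib sum_distrib_left)
  also have "(\<Sum>s\<in>?S. \<Sum>j\<in>UNIV. \<sigma> $ j * (pmf p s * D s $ j))
      = (\<Sum>j\<in>UNIV. \<sigma> $ j * (\<Sum>s\<in>?S. pmf p s * D s $ j))"
    by (subst sum.swap) (simp only: sum_distrib_left)
  finally show c: "c = 0"
    by (simp only: moments) simp
  have "\<sigma> $ i = 0" for i
  proof -
    have "0 = (\<Sum>s\<in>?S. pmf p s * ((\<sigma> \<bullet> D s) * D s $ i))"
      using zero c by simp
    also have "\<dots> = (\<Sum>s\<in>?S. \<Sum>j\<in>UNIV. \<sigma> $ j * (pmf p s * (D s $ j * D s $ i)))"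
      by (simp add: inner_vec_def algebra_simps sum_distrib_left)
    also have "\<dots> = (\<Sum>j\<in>UNIV. \<sigma> $ j * (\<Sum>s\<in>?S. pmf p s * (D s $ j * D s $ i)))"
      by (subst sum.swap) (simp only: sum_distrib_left)
    finally show ?thesis
      by (simp only: moments) (simp add: if_distrib[of "\<lambda>x. _ * x"] cong: if_cong)
  qed
  then show "\<sigma> = 0"
    by (simp add: vec_eq_iff)
qed

text \<open>No nonzero vector is orthogonal to all the vectors \<open>(1, D s)\<close>, so these span \<open>\<real> \<times> \<real>\<^sup>n\<close>. There are
  \<open>n + 1\<close> of them, so they form a basis, on which a linear functional can be prescribed freely.\<close>

lemma affine_interpolation:
  fixes D :: "nat \<Rightarrow> real ^ 'n" and f :: "nat \<Rightarrow> real"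
  assumes std: "standard_increment p D"
  obtains c \<sigma> where "\<And>s. s \<in> {0..CARD('n)} \<Longrightarrow> f s = c + \<sigma> \<bullet> D s"
proof -
  let ?S = "{0..CARD('n)}"
  define e where "e s = (1 :: real, D s)" for s
  have inj: "inj_on e ?S"
    using std unfolding standard_increment_def e_def inj_on_def by auto
  have dim: "DIM(real \<times> (real ^ 'n)) = Suc CARD('n)"
    by simp
  have "dim (e ` ?S) = DIM(real \<times> (real ^ 'n))"
  proof (rule ccontr)
    assume "dim (e ` ?S) \<noteq> DIM(real \<times> (real ^ 'n))"
    then have "dim (e ` ?S) < DIM(real \<times> (real ^ 'n))"
      using dim_subset_UNIV[of "e ` ?S"] by linarith
    then obtain x where x: "x \<noteq> 0" "\<And>y. y \<in> span (e ` ?S) \<Longrightarrow> orthogonal x y"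
      using orthogonal_to_subspace_exists by blast
    have "fst x + snd x \<bullet> D s = 0" if "s \<in> ?S" for s
      using x(2)[of "e s"] that
      by (auto simp: e_def orthogonal_def inner_prod_def span_base)
    then have "fst x = 0" "snd x = 0"
      using affine_vanishing_on_increments[OF std] by blast+
    with x(1) show False
      by (simp add: prod_eq_iff)
  qed
  then have "independent (e ` ?S)"
    using dim inj by (intro card_le_dim_spanning[of _ "e ` ?S"])
      (auto simp: card_image span_superset)
  then obtain g where g: "linear g" "\<And>x. x \<in> e ` ?S \<Longrightarrow> g x = f (inv_into ?S e x)"
    using linear_independent_extend[of "e ` ?S" "\<lambda>x. f (inv_into ?S e x)"] by blast
  \<comment> \<open>The adjoint of a linear functional at \<open>1\<close> is the vector that represents it.\<close>
  have "f s = g (1, 0) + adjoint (\<lambda>y. g (0, y)) 1 \<bullet> D s" if "s \<in> ?S" for s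
  proof -
    have lin: "linear (\<lambda>y. g (0, y))"
      using linear_compose[OF _ g(1), of "\<lambda>y. (0, y)"]
      by (simp add: o_def linear_iff)
    have "f s = g ((1, 0) + (0, D s))"
      using g(2)[OF imageI[OF that, of e]] inv_into_f_f[OF inj that]
      by (simp add: e_def)
    also have "\<dots> = g (1, 0) + g (0, D s)"
      using g(1) by (rule linear_add)
    also have "g (0, D s) = adjoint (\<lambda>y. g (0, y)) 1 \<bullet> D s"
      using adjoint_works[OF lin, of "D s" 1] by (simp add: inner_commute)
    finally show ?thesis .
  qed
  with that show thesis
    by blast
qed

section \<open>The lattice carrying the walk\<close>

definition node :: "(nat \<Rightarrow> real ^ 'n) \<Rightarrow> real ^ 'n \<Rightarrow> nat \<Rightarrow> real ^ 'n \<Rightarrow> bool" where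
  "node D w0 t w \<longleftrightarrow>
     (\<exists>steps. (\<forall>k. steps k \<in> {0..CARD('n)}) \<and> w = w0 + (\<Sum>k=1..t. D (steps k)))"

lemma node_0: "node D w0 0 w \<longleftrightarrow> w = w0"
  unfolding node_def by (auto intro: exI[of _ "\<lambda>_. 0"])

lemma node_Suc:
  fixes D :: "nat \<Rightarrow> real ^ 'n"
  shows "node D w0 (Suc t) w' \<longleftrightarrow>
    (\<exists>w s. node D w0 t w \<and> s \<in> {0..CARD('n)} \<and> w' = w + D s)"
proof (intro iffI)
  assume "\<exists>w s. node D w0 t w \<and> s \<in> {0..CARD('n)} \<and> w' = w + D s"
  then obtain steps s where "\<forall>k. steps k \<in> {0..CARD('n)}" "s \<in> {0..CARD('n)}"
    "w' = w0 + (\<Sum>k=1..t. D (steps k)) + D s"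
    unfolding node_def by blast
  then show "node D w0 (Suc t) w'"
    unfolding node_def by (intro exI[of _ "steps(Suc t := s)"]) (auto simp: add.assoc)
next
  assume "node D w0 (Suc t) w'"
  then obtain steps where "\<forall>k. steps k \<in> {0..CARD('n)}"
    "w' = w0 + (\<Sum>k=1..Suc t. D (steps k))"
    unfolding node_def by blast
  then have "node D w0 t (w0 + (\<Sum>k=1..t. D (steps k)))" "steps (Suc t) \<in> {0..CARD('n)}"
    "w' = w0 + (\<Sum>k=1..t. D (steps k)) + D (steps (Suc t))"
    unfolding node_def by (auto simp: add.assoc)
  then show "\<exists>w s. node D w0 t w \<and> s \<in> {0..CARD('n)} \<and> w' = w + D s"
    by blast
qed

text \<open>The walk together with the two facts that make it interchangeable with the lattice: it stays on
  the lattice almost surely (\<open>AE_node_walk\<close>), and no almost sure property can exclude a given path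
  (\<open>ex_outcome_on_path\<close>).\<close>

locale increment_walk = prob_space M
  for M :: "'a measure" and p :: "nat pmf" and D :: "nat \<Rightarrow> real ^ 'n"
    and dw :: "nat \<Rightarrow> 'a \<Rightarrow> real ^ 'n" and w0 :: "real ^ 'n" +
  assumes std: "standard_increment p D"
    and copies: "independent_copies M p D dw"
begin

lemma dw_measurable: "u \<ge> 1 \<Longrightarrow> dw u \<in> borel_measurable M"
  using copies unfolding independent_copies_def indep_vars_def by auto

lemma dw_distr: "u \<ge> 1 \<Longrightarrow> distr M borel (dw u) = distr (measure_pmf p) borel D"
  using copies unfolding independent_copies_def by blast

lemma AE_dw_range: "u \<ge> 1 \<Longrightarrow> AE \<omega> in M. dw u \<omega> \<in> D ` {0..CARD('n)}"
proof -
  assume u: "u \<ge> 1"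
  have supp: "set_pmf p = {0..CARD('n)}"
    using std unfolding standard_increment_def by blast
  have meas: "{x \<in> space borel. x \<in> D ` {0..CARD('n)}} \<in> sets borel"
    by (simp add: borel_closed finite_imp_closed)
  have "AE x in distr (measure_pmf p) borel D. x \<in> D ` {0..CARD('n)}"
    using meas supp by (subst AE_distr_iff) (auto simp: AE_measure_pmf_iff)
  then have "AE x in distr M borel (dw u). x \<in> D ` {0..CARD('n)}"
    by (simp only: dw_distr[OF u])
  then show ?thesis
    by (rule AE_distrD[OF dw_measurable[OF u]])
qed

lemma dw_prob_pos:
  assumes "u \<ge> 1" and "s \<in> {0..CARD('n)}"
  shows "0 < prob (dw u -` {D s} \<inter> space M)"
proof -
  have "0 < pmf p s"
    using assms(2) std unfolding standard_increment_def by (simp add: pmf_positive)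
  also have "pmf p s \<le> measure (measure_pmf p) (D -` {D s})"
    unfolding pmf.rep_eq by (intro measure_pmf.finite_measure_mono) auto
  also have "\<dots> = measure (distr (measure_pmf p) borel D) {D s}"
    by (simp add: measure_distr)
  also have "\<dots> = prob (dw u -` {D s} \<inter> space M)"
    using dw_measurable[OF assms(1)] by (simp add: dw_distr[OF assms(1), symmetric] measure_distr)
  finally show ?thesis .
qed

text \<open>By independence, the event that the walk follows a prescribed path has a product of positive numbers
  as its probability, so it cannot lie inside a null set.\<close>

lemma ex_outcome_on_path:
  assumes steps: "\<And>k. steps k \<in> {0..CARD('n)}" and Q: "AE \<omega> in M. Q \<omega>"
  shows "\<exists>\<omega>. Q \<omega> \<and> (\<forall>k\<in>{1..t}. dw k \<omega> = D (steps k))"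
proof (rule ccontr)
  assume no: "\<not> ?thesis"
  \<comment> \<open>One step more than required, so that the intersection is never over the empty set.\<close>
  let ?E = "\<Inter>k\<in>{1..Suc t}. dw k -` {D (steps k)} \<inter> space M"
  have "prob ?E = (\<Prod>k\<in>{1..Suc t}. prob (dw k -` {D (steps k)} \<inter> space M))"
    using copies unfolding independent_copies_def
    by (intro indep_varsD[of "\<lambda>_. borel" dw "{1..}"]) auto
  also have "\<dots> > 0"
    using steps by (intro prod_pos) (auto intro!: dw_prob_pos)
  finally have "0 < prob ?E" .
  moreover have "prob ?E = 0"
  proof -
    have "AE \<omega> in M. \<omega> \<notin> ?E"
      using Q by eventually_elim (use no in auto)
    moreover have "?E \<in> sets M"
      by (intro sets.finite_INT measurable_sets[OF dw_measurable]) auto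
    ultimately show ?thesis
      by (simp only: prob_eq_0)
  qed
  ultimately show False
    by simp
qed

text \<open>Transfers an almost sure relation that also involves the next increment, such as stationarity, to a
  single edge of the lattice.\<close>

lemma node_step_outcome:
  assumes "node D w0 t w" and s: "s \<in> {0..CARD('n)}" and Q: "AE \<omega> in M. Q \<omega>"
  obtains \<omega> where "Q \<omega>" and "walk w0 dw t \<omega> = w" and "dw (Suc t) \<omega> = D s"
    and "walk w0 dw (Suc t) \<omega> = w + D s"
proof -
  obtain steps where steps: "\<And>k. steps k \<in> {0..CARD('n)}" "w = w0 + (\<Sum>k=1..t. D (steps k))"
    using assms(1) unfolding node_def by blast
  have "\<exists>\<omega>. Q \<omega> \<and> (\<forall>k\<in>{1..Suc t}. dw k \<omega> = D ((steps(Suc t := s)) k))"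
    using steps s Q by (intro ex_outcome_on_path) auto
  then obtain \<omega> where \<omega>: "Q \<omega>"
    "\<And>k. k \<in> {1..Suc t} \<Longrightarrow> dw k \<omega> = D ((steps(Suc t := s)) k)"
    by blast
  have "(\<Sum>k=1..t. dw k \<omega>) = (\<Sum>k=1..t. D (steps k))"
    by (intro sum.cong refl) (auto simp: \<omega>(2))
  then have walk: "walk w0 dw t \<omega> = w"
    unfolding walk_def steps(2) by simp
  moreover have last: "dw (Suc t) \<omega> = D s"
    using \<omega>(2)[of "Suc t"] by simp
  moreover have "walk w0 dw (Suc t) \<omega> = w + D s"
    using walk last unfolding walk_def by (simp add: add.assoc[symmetric])
  ultimately show thesis
    using that \<omega>(1) by blast
qed

lemma AE_node_walk: "AE \<omega> in M. node D w0 t (walk w0 dw t \<omega>)"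
proof (induction t)
  case 0
  show ?case by (simp add: walk_def node_0)
next
  case (Suc t)
  have "AE \<omega> in M. dw (Suc t) \<omega> \<in> D ` {0..CARD('n)}"
    by (rule AE_dw_range) simp
  with Suc show ?case
  proof eventually_elim
    case (elim \<omega>)
    then obtain s where "s \<in> {0..CARD('n)}" "dw (Suc t) \<omega> = D s"
      by blast
    moreover have "walk w0 dw (Suc t) \<omega> = walk w0 dw t \<omega> + dw (Suc t) \<omega>"
      by (simp add: walk_def add.assoc)
    ultimately show ?case
      using elim(1) by (metis node_Suc)
  qed
qed

lemma AE_walk_iff_nodes:
  "(AE \<omega> in M. Q (walk w0 dw t \<omega>)) \<longleftrightarrow> (\<forall>w. node D w0 t w \<longrightarrow> Q w)"
proof (intro iffI allI impI)
  fix w assume Q: "AE \<omega> in M. Q (walk w0 dw t \<omega>)" and w: "node D w0 t w"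
  have "0 \<in> {0..CARD('n)}"
    by simp
  then show "Q w"
    by (rule node_step_outcome[OF w _ Q]) simp
next
  assume "\<forall>w. node D w0 t w \<longrightarrow> Q w"
  then show "AE \<omega> in M. Q (walk w0 dw t \<omega>)"
    by (intro eventually_mono[OF AE_node_walk[of t]]) simp
qed

lemma reachable_imp_node:
  assumes "reachable M (state w0 dw) t i"
  obtains w where "node D w0 t w" and "i = (real t, w)"
proof -
  have "\<not> (AE \<omega> in M. state w0 dw t \<omega> \<noteq> i)"
  proof
    assume "AE \<omega> in M. state w0 dw t \<omega> \<noteq> i"
    then have "prob {\<omega> \<in> space M. state w0 dw t \<omega> = i} = 0"
      by (cases "{\<omega> \<in> space M. state w0 dw t \<omega> = i} \<in> events")
        (auto simp: prob_eq_0 measure_notin_sets)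
    then show False
      using assms unfolding reachable_def by simp
  qed
  then have "\<exists>w. node D w0 t w \<and> i = (real t, w)"
    using AE_walk_iff_nodes[of "\<lambda>w. (real t, w) \<noteq> i" t] by (auto simp: state_def)
  with that show thesis
    by blast
qed

lemma reachable_start: "reachable M (state w0 dw) 0 (0, w0)"
  unfolding reachable_def state_def walk_def by (simp add: prob_space)

end

section \<open>Prices on the lattice\<close>

text \<open>The double sum in the dynamics. Its recursion in \<open>t\<close> below has the same form as the recursion that
  stationarity imposes on the logarithms of the prices.\<close>

definition cumulated_drift :: "(nat \<Rightarrow> real) \<Rightarrow> nat \<Rightarrow> nat \<Rightarrow> real" where
  "cumulated_drift \<mu> t T = (\<Sum>u<T. \<Sum>v=1..t. \<mu> (u + v - 1))"

lemma cumulated_drift_Suc: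
  "cumulated_drift \<mu> (Suc t) T
    = (\<Sum>u<T. \<mu> u) + cumulated_drift \<mu> t (Suc T) - cumulated_drift \<mu> t 1"
proof -
  have "(\<Sum>v=1..Suc t. \<mu> (u + v - 1)) = \<mu> u + (\<Sum>v=1..t. \<mu> (Suc u + v - 1))" for u
  proof -
    have "(\<Sum>v=1..Suc t. \<mu> (u + v - 1)) = \<mu> u + (\<Sum>v=Suc 1..Suc t. \<mu> (u + v - 1))"
      by (subst sum.atLeast_Suc_atMost) simp_all
    also have "(\<Sum>v=Suc 1..Suc t. \<mu> (u + v - 1)) = (\<Sum>v=1..t. \<mu> (Suc u + v - 1))"
      by (subst sum.shift_bounds_cl_Suc_ivl) simp
    finally show ?thesis .
  qed
  moreover have "cumulated_drift \<mu> t (Suc T) - cumulated_drift \<mu> t 1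
      = (\<Sum>u<T. \<Sum>v=1..t. \<mu> (Suc u + v - 1))"
    unfolding cumulated_drift_def by (subst sum.lessThan_Suc_shift) simp
  ultimately show ?thesis
    unfolding cumulated_drift_def by (simp add: sum.distrib)
qed

text \<open>The hypothesis \<open>exchange\<close> is the equality of the two prices obtained by making the steps \<open>s\<close> and
  \<open>s'\<close> in either order. It forces the differences \<open>g T s - g T 0\<close> to grow linearly in \<open>T\<close>, with
  slope \<open>g 1 s - g 1 0\<close>; that slope is linear in \<open>D s - D 0\<close> by affine interpolation, and the rest of
  \<open>g T s\<close> depends on \<open>T\<close> only.\<close>

lemma exchangeable_step_affine:
  fixes D :: "nat \<Rightarrow> real ^ 'n" and g :: "nat \<Rightarrow> nat \<Rightarrow> real"
  assumes std: "standard_increment p D"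
    and zero: "\<And>s. s \<in> {0..CARD('n)} \<Longrightarrow> g 0 s = 0"
    and exchange: "\<And>T s s'. s \<in> {0..CARD('n)} \<Longrightarrow> s' \<in> {0..CARD('n)} \<Longrightarrow>
      g T s' + g (Suc T) s - g 1 s = g T s + g (Suc T) s' - g 1 s'"
  shows "\<exists>\<sigma> \<mu>. \<forall>T. \<forall>s\<in>{0..CARD('n)}. g T s = - real T * (\<sigma> \<bullet> D s) - (\<Sum>u<T. \<mu> u)"
proof -
  have differences: "g T s - g T 0 = real T * (g 1 s - g 1 0)" if s: "s \<in> {0..CARD('n)}" for T s
  proof (induction T)
    case 0
    show ?case using zero s by simp
  next
    case (Suc T)
    then show ?case
      using exchange[OF s, of 0 T] by (simp add: algebra_simps)
  qed
  obtain c \<sigma>' where g1: "\<And>s. s \<in> {0..CARD('n)} \<Longrightarrow> g 1 s = c + \<sigma>' \<bullet> D s"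
    using affine_interpolation[OF std, of "g 1"] by blast
  \<comment> \<open>\<open>- G T\<close> is the part of \<open>g T s\<close> that is free of \<open>s\<close>; the drift \<open>\<mu>\<close> consists of the increments of \<open>G\<close>.\<close>
  define G where "G T = - g T 0 + real T * (\<sigma>' \<bullet> D 0)" for T
  have G0: "G 0 = 0"
    by (simp add: G_def zero)
  have "g T s = - real T * (- \<sigma>' \<bullet> D s) - (\<Sum>u<T. G (Suc u) - G u)"
    if s: "s \<in> {0..CARD('n)}" for T s
  proof -
    have "g 1 s - g 1 0 = \<sigma>' \<bullet> D s - \<sigma>' \<bullet> D 0"
      using g1[OF s] g1[of 0] by simp
    then have "g T s - g T 0 = real T * (\<sigma>' \<bullet> D s) - real T * (\<sigma>' \<bullet> D 0)"
      using differences[OF s, of T] by (simp only: right_diff_distrib)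
    moreover have "(\<Sum>u<T. G (Suc u) - G u) = G T"
      unfolding sum_lessThan_telescope G0 by simp
    ultimately show ?thesis
      unfolding G_def inner_minus_left by linarith
  qed
  then show ?thesis
    by (intro exI[of _ "- \<sigma>'"] exI[of _ "\<lambda>u. G (Suc u) - G u"] allI ballI)
qed

text \<open>The exchange property comes from the points \<open>w0 + D s + D s'\<close> at time 2, whose price is
  computed along both paths; it determines the one-step function for all later times because
  \<open>g\<close> does not depend on \<open>t\<close>.\<close>

lemma log_price_solution:
  fixes D :: "nat \<Rightarrow> real ^ 'n" and g :: "nat \<Rightarrow> nat \<Rightarrow> real"
    and l :: "nat \<Rightarrow> nat \<Rightarrow> real ^ 'n \<Rightarrow> real"
  assumes std: "standard_increment p D"
    and zero: "\<And>t w. node D w0 t w \<Longrightarrow> l t 0 w = 0"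
    and step: "\<And>t T w s. node D w0 t w \<Longrightarrow> s \<in> {0..CARD('n)} \<Longrightarrow>
      l (Suc t) T (w + D s) = g T s + l t (Suc T) w - l t 1 w"
  shows "\<exists>\<sigma> \<mu>. \<forall>t T w. node D w0 t w \<longrightarrow>
    l t T w = l 0 (t + T) w0 - l 0 t w0 - real T * (\<sigma> \<bullet> (w - w0)) - cumulated_drift \<mu> t T"
proof -
  have start: "node D w0 0 w0"
    by (simp add: node_0)
  have first: "node D w0 (Suc 0) (w0 + D s)" if "s \<in> {0..CARD('n)}" for s
    using start that unfolding node_Suc by blast
  have g0: "g 0 s = 0" if s: "s \<in> {0..CARD('n)}" for s
    using step[OF start s, of 0] zero[OF first[OF s]] by simp
  have exchange: "g T s' + g (Suc T) s - g 1 s = g T s + g (Suc T) s' - g 1 s'"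
    if s: "s \<in> {0..CARD('n)}" and s': "s' \<in> {0..CARD('n)}" for T s s'
    using step[OF first[OF s] s', of T] step[OF first[OF s'] s, of T]
      step[OF start s, of 1] step[OF start s', of 1]
      step[OF start s, of "Suc T"] step[OF start s', of "Suc T"]
    by (simp add: add_ac)
  have "\<exists>\<sigma> \<mu>. \<forall>T. \<forall>s\<in>{0..CARD('n)}. g T s = - real T * (\<sigma> \<bullet> D s) - (\<Sum>u<T. \<mu> u)"
    by (rule exchangeable_step_affine[where g = g, OF std]) (fact g0, fact exchange)
  then obtain \<sigma> \<mu> where g:
    "\<And>T s. s \<in> {0..CARD('n)} \<Longrightarrow> g T s = - real T * (\<sigma> \<bullet> D s) - (\<Sum>u<T. \<mu> u)"
    by blast
  have "l t T w = l 0 (t + T) w0 - l 0 t w0 - real T * (\<sigma> \<bullet> (w - w0)) - cumulated_drift \<mu> t T"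
    if "node D w0 t w" for t T w
    using that
  proof (induction t arbitrary: T w)
    case 0
    then show ?case
      by (simp add: node_0 zero[OF start] cumulated_drift_def)
  next
    case (Suc t)
    then obtain w' s where w': "node D w0 t w'" and s: "s \<in> {0..CARD('n)}" and w: "w = w' + D s"
      unfolding node_Suc by blast
    show ?case
      unfolding w step[OF w' s] g[OF s] Suc.IH[OF w'] cumulated_drift_Suc
      by (simp add: algebra_simps inner_add_right inner_diff_right)
  qed
  then show ?thesis
    by blast
qed

text \<open>Taking logarithms turns the right-hand sum into a function of \<open>T\<close> that vanishes at \<open>0\<close>, since \<open>q\<close>
  has total mass one, and whose increments are the values that the drift condition prescribes.\<close>

lemma drift_condition_iff_exponential:
  fixes D :: "nat \<Rightarrow> real ^ 'n"
  shows "drift_condition D \<sigma> \<mu> \<longleftrightarrow>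
    (\<exists>q. positive_prob {0..CARD('n)} q \<and>
      (\<forall>T. exp (\<Sum>u<T. \<mu> u) = (\<Sum>s\<in>{0..CARD('n)}. q s * exp (- real T * (\<sigma> \<bullet> D s)))))"
proof -
  let ?E = "\<lambda>q T. \<Sum>s\<in>{0..CARD('n)}. q s * exp (- real T * (\<sigma> \<bullet> D s))"
  have "(\<forall>T. \<mu> T = ln (?E q (T + 1) / ?E q T)) \<longleftrightarrow> (\<forall>T. exp (\<Sum>u<T. \<mu> u) = ?E q T)"
    if q: "positive_prob {0..CARD('n)} q" for q
  proof -
    have pos: "?E q T > 0" for T
      using q unfolding positive_prob_def by (intro sum_pos) auto
    have one: "?E q 0 = 1"
      using q unfolding positive_prob_def by simp
    show ?thesis
    proof (intro iffI allI)
      fix T assume ln: "\<forall>T. \<mu> T = ln (?E q (T + 1) / ?E q T)"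
      show "exp (\<Sum>u<T. \<mu> u) = ?E q T"
      proof (induction T)
        case 0
        show ?case using one by simp
      next
        case (Suc T)
        have "exp (\<mu> T) = ?E q (Suc T) / ?E q T"
          unfolding ln[rule_format, of T] using pos[of T] pos[of "Suc T"] by simp
        then show ?case
          using Suc pos[of T] by (simp add: exp_add)
      qed
    next
      fix T assume ex: "\<forall>T. exp (\<Sum>u<T. \<mu> u) = ?E q T"
      have "?E q (T + 1) / ?E q T = exp (\<mu> T)"
        unfolding ex[rule_format, symmetric] by (simp add: exp_add)
      then show "\<mu> T = ln (?E q (T + 1) / ?E q T)"
        by simp
    qed
  qed
  then show ?thesis
    unfolding drift_condition_def by blast
qed

text \<open>Both sides of the pricing equation carry the positive factor \<open>K\<close>, namely
  \<open>v t (T + 1) w * exp (- (\<Sum>u<T. \<mu> u))\<close>: by the recursion of the cumulated drift, one step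
  after \<open>(t, w)\<close> the only traces of the step are \<open>exp (- T * (\<sigma> \<bullet> D s))\<close> and the sum of \<open>\<mu>\<close>.\<close>

lemma one_step_pricing_iff:
  fixes D :: "nat \<Rightarrow> real ^ 'n" and v :: "nat \<Rightarrow> nat \<Rightarrow> real ^ 'n \<Rightarrow> real" and b :: "nat \<Rightarrow> real"
  assumes b: "\<And>T. b T > 0"
    and v: "\<And>t T w. node D w0 t w \<Longrightarrow>
      v t T w = b (t + T) / b t * exp (- real T * (\<sigma> \<bullet> (w - w0)) - cumulated_drift \<mu> t T)"
    and w: "node D w0 t w"
  shows "v t (T + 1) w = v t 1 w * (\<Sum>s\<in>{0..CARD('n)}. q s * v (t + 1) T (w + D s)) \<longleftrightarrow>
    exp (\<Sum>u<T. \<mu> u) = (\<Sum>s\<in>{0..CARD('n)}. q s * exp (- real T * (\<sigma> \<bullet> D s)))"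
proof -
  let ?S = "{0..CARD('n)}"
  define K where "K = v t (T + 1) w * exp (- (\<Sum>u<T. \<mu> u))"
  have K: "K > 0"
    unfolding K_def v[OF w] using b by simp
  have "v t 1 w * v (t + 1) T (w + D s) = K * exp (- real T * (\<sigma> \<bullet> D s))" if "s \<in> ?S" for s
  proof -
    have "node D w0 (t + 1) (w + D s)"
      using w that node_Suc by fastforce
    note v' = v[OF this]
    have "v t 1 w * v (t + 1) T (w + D s) = b (Suc (t + T)) / b t *
        exp ((- real 1 * (\<sigma> \<bullet> (w - w0)) - cumulated_drift \<mu> t 1)
          + (- real T * (\<sigma> \<bullet> (w + D s - w0)) - cumulated_drift \<mu> (Suc t) T))"
      unfolding v' v[OF w] exp_add using b[of "Suc t"] by simp
    also have "(- real 1 * (\<sigma> \<bullet> (w - w0)) - cumulated_drift \<mu> t 1)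
          + (- real T * (\<sigma> \<bullet> (w + D s - w0)) - cumulated_drift \<mu> (Suc t) T)
        = (- real (T + 1) * (\<sigma> \<bullet> (w - w0)) - cumulated_drift \<mu> t (T + 1))
          + - (\<Sum>u<T. \<mu> u) + - real T * (\<sigma> \<bullet> D s)"
      unfolding cumulated_drift_Suc by (simp add: algebra_simps inner_add_right inner_diff_right)
    also have "b (Suc (t + T)) / b t * exp \<dots> = K * exp (- real T * (\<sigma> \<bullet> D s))"
      unfolding K_def v[OF w] exp_add by simp
    finally show ?thesis .
  qed
  then have "v t 1 w * (\<Sum>s\<in>?S. q s * v (t + 1) T (w + D s))
      = (\<Sum>s\<in>?S. q s * (K * exp (- real T * (\<sigma> \<bullet> D s))))"
    unfolding sum_distrib_left by (intro sum.cong refl) (simp add: mult.left_commute)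
  also have "\<dots> = K * (\<Sum>s\<in>?S. q s * exp (- real T * (\<sigma> \<bullet> D s)))"
    unfolding sum_distrib_left by (simp add: mult.left_commute)
  finally have "v t 1 w * (\<Sum>s\<in>?S. q s * v (t + 1) T (w + D s))
      = K * (\<Sum>s\<in>?S. q s * exp (- real T * (\<sigma> \<bullet> D s)))" .
  moreover have "v t (T + 1) w = K * exp (\<Sum>u<T. \<mu> u)"
    unfolding K_def by (simp add: exp_minus)
  ultimately show ?thesis
    using K by simp
qed

section \<open>Term structures on the walk\<close>

context increment_walk
begin

lemma dynamics_iff_nodes:
  assumes "state_dependent M (state w0 dw) P V"
  shows "dynamics M w0 dw P \<sigma> \<mu> \<longleftrightarrow>
    (\<forall>t T w. node D w0 t w \<longrightarrow>
      V t T (real t, w) = V 0 (t + T) (0, w0) / V 0 t (0, w0) *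
        exp (- real T * (\<sigma> \<bullet> (w - w0)) - cumulated_drift \<mu> t T))"
proof -
  have P: "AE \<omega> in M. P t T \<omega> = V t T (real t, walk w0 dw t \<omega>)" for t T
    using assms unfolding state_dependent_def state_def by blast
  have P0: "AE \<omega> in M. P 0 T \<omega> = V 0 T (0, w0)" for T
    using P[of 0 T] by (simp add: walk_def)
  let ?v = "\<lambda>t T w. V 0 (t + T) (0, w0) / V 0 t (0, w0) *
    exp (- real T * (\<sigma> \<bullet> (w - w0)) - cumulated_drift \<mu> t T)"
  have "(AE \<omega> in M. P t T \<omega> = P 0 (t + T) \<omega> / P 0 t \<omega> *
          exp (- real T * (\<sigma> \<bullet> (walk w0 dw t \<omega> - w0)) - (\<Sum>u<T. \<Sum>v=1..t. \<mu> (u + v - 1))))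
      \<longleftrightarrow> (\<forall>w. node D w0 t w \<longrightarrow> V t T (real t, w) = ?v t T w)" for t T
  proof -
    have "(AE \<omega> in M. P t T \<omega> = P 0 (t + T) \<omega> / P 0 t \<omega> *
          exp (- real T * (\<sigma> \<bullet> (walk w0 dw t \<omega> - w0)) - (\<Sum>u<T. \<Sum>v=1..t. \<mu> (u + v - 1))))
      \<longleftrightarrow> (AE \<omega> in M. V t T (real t, walk w0 dw t \<omega>) = ?v t T (walk w0 dw t \<omega>))"
      by (rule eventually_subst,
          use P[of t T] P0[of "t + T"] P0[of t] in eventually_elim, simp add: cumulated_drift_def)
    also have "\<dots> \<longleftrightarrow> (\<forall>w. node D w0 t w \<longrightarrow> V t T (real t, w) = ?v t T w)"
      by (rule AE_walk_iff_nodes)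
    finally show ?thesis .
  qed
  then show ?thesis
    unfolding dynamics_def by (simp only:)
qed

lemma node_price_pos:
  assumes "term_structure M P" and "state_dependent M (state w0 dw) P V" and "node D w0 t w"
  shows "0 < V t T (real t, w)"
proof -
  have "AE \<omega> in M. 0 < P t T \<omega>" "AE \<omega> in M. P t T \<omega> = V t T (real t, walk w0 dw t \<omega>)"
    using assms(1,2) unfolding term_structure_def state_dependent_def state_def by blast+
  then have "AE \<omega> in M. 0 < V t T (real t, walk w0 dw t \<omega>)"
    by eventually_elim simp
  with assms(3) show ?thesis
    using AE_walk_iff_nodes[of "\<lambda>w. 0 < V t T (real t, w)"] by blast
qed

lemma node_price_at_maturity:
  assumes "term_structure M P" and "state_dependent M (state w0 dw) P V" and "node D w0 t w"
  shows "V t 0 (real t, w) = 1"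
proof -
  have "AE \<omega> in M. P t 0 \<omega> = 1" "AE \<omega> in M. P t 0 \<omega> = V t 0 (real t, walk w0 dw t \<omega>)"
    using assms(1,2) unfolding term_structure_def state_dependent_def state_def by blast+
  then have "AE \<omega> in M. V t 0 (real t, walk w0 dw t \<omega>) = 1"
    by eventually_elim simp
  with assms(3) show ?thesis
    using AE_walk_iff_nodes[of "\<lambda>w. V t 0 (real t, w) = 1"] by blast
qed

text \<open>The increment of the state along the edge \<open>s\<close> is \<open>(1, D s)\<close> at every time, so the function in
  the stationarity condition becomes a function of \<open>s\<close>.\<close>

lemma node_price_stationary:
  assumes "state_dependent M (state w0 dw) P V" and "stationary M (state w0 dw) P"
  shows "\<exists>h :: nat \<Rightarrow> nat \<Rightarrow> real. \<forall>t T w. \<forall>s\<in>{0..CARD('n)}. node D w0 t w \<longrightarrow>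
      V (Suc t) T (real (Suc t), w + D s) * V t 1 (real t, w) / V t (Suc T) (real t, w) = h T s"
proof -
  have P: "AE \<omega> in M. P t T \<omega> = V t T (real t, walk w0 dw t \<omega>)" for t T
    using assms(1) unfolding state_dependent_def state_def by blast
  obtain h where h: "\<And>t T. t \<ge> 1 \<Longrightarrow> AE \<omega> in M. P t T \<omega> * P (t - 1) 1 \<omega> / P (t - 1) (T + 1) \<omega>
      = h T (state w0 dw t \<omega> - state w0 dw (t - 1) \<omega>)"
    using assms(2) unfolding stationary_def by blast
  have "V (Suc t) T (real (Suc t), w + D s) * V t 1 (real t, w) / V t (Suc T) (real t, w)
      = h T (1, D s)" if w: "node D w0 t w" and s: "s \<in> {0..CARD('n)}" for t T w s
  proof -
    have "AE \<omega> in M. P (Suc t) T \<omega> * P t 1 \<omega> / P t (Suc T) \<omega>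
        = h T (state w0 dw (Suc t) \<omega> - state w0 dw t \<omega>)"
      using h[of "Suc t" T] by simp
    with P[of "Suc t" T] P[of t 1] P[of t "Suc T"]
    have "AE \<omega> in M. V (Suc t) T (real (Suc t), walk w0 dw (Suc t) \<omega>)
        * V t 1 (real t, walk w0 dw t \<omega>) / V t (Suc T) (real t, walk w0 dw t \<omega>)
        = h T (state w0 dw (Suc t) \<omega> - state w0 dw t \<omega>)"
      by eventually_elim simp
    then show ?thesis
      by (rule node_step_outcome[OF w s]) (simp add: state_def)
  qed
  then show ?thesis
    by (intro exI[of _ "\<lambda>T s. h T (1, D s)"]) blast
qed

lemma ex_dynamics:
  assumes "term_structure M P" and "state_dependent M (state w0 dw) P V"
    and "stationary M (state w0 dw) P"
  shows "\<exists>\<sigma> \<mu>. dynamics M w0 dw P \<sigma> \<mu>"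
proof -
  note pos = node_price_pos[OF assms(1,2)]
  note zero = node_price_at_maturity[OF assms(1,2)]
  obtain h where step: "\<And>t T w s. node D w0 t w \<Longrightarrow> s \<in> {0..CARD('n)} \<Longrightarrow>
      V (Suc t) T (real (Suc t), w + D s) * V t 1 (real t, w) / V t (Suc T) (real t, w) = h T s"
    using node_price_stationary[OF assms(2,3)] by blast
  define l where "l t T w = ln (V t T (real t, w))" for t T w
  have "l t 0 w = 0" if "node D w0 t w" for t w
    using zero[OF that] by (simp add: l_def)
  moreover have "l (Suc t) T (w + D s) = ln (h T s) + l t (Suc T) w - l t 1 w"
    if w: "node D w0 t w" and s: "s \<in> {0..CARD('n)}" for t T w s
  proof -
    have "node D w0 (Suc t) (w + D s)"
      using w s unfolding node_Suc by blast
    note positive = pos[OF this, of T] pos[OF w, of "Suc T"] pos[OF w, of 1]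
    then show ?thesis
      unfolding l_def step[OF w s, symmetric] by (simp add: ln_mult ln_div)
  qed
  ultimately have "\<exists>\<sigma> \<mu>. \<forall>t T w. node D w0 t w \<longrightarrow>
    l t T w = l 0 (t + T) w0 - l 0 t w0 - real T * (\<sigma> \<bullet> (w - w0)) - cumulated_drift \<mu> t T"
    by (rule log_price_solution[OF std, where g = "\<lambda>T s. ln (h T s)"])
  then obtain \<sigma> \<mu> where l: "\<And>t T w. node D w0 t w \<Longrightarrow>
    l t T w = l 0 (t + T) w0 - l 0 t w0 - real T * (\<sigma> \<bullet> (w - w0)) - cumulated_drift \<mu> t T"
    by blast
  have "V t T (real t, w) = V 0 (t + T) (0, w0) / V 0 t (0, w0) *
      exp (- real T * (\<sigma> \<bullet> (w - w0)) - cumulated_drift \<mu> t T)" if w: "node D w0 t w" for t T w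
  proof -
    have pos0: "0 < V 0 T (0, w0)" for T
      using pos[of 0 w0 T] by (simp add: node_0)
    have "V t T (real t, w) = exp (l t T w)"
      using pos[OF w] by (simp add: l_def)
    also have "l t T w = l 0 (t + T) w0 - l 0 t w0
        + (- real T * (\<sigma> \<bullet> (w - w0)) - cumulated_drift \<mu> t T)"
      using l[OF w] by simp
    also have "exp \<dots> = V 0 (t + T) (0, w0) / V 0 t (0, w0) *
        exp (- real T * (\<sigma> \<bullet> (w - w0)) - cumulated_drift \<mu> t T)"
      using pos0 unfolding exp_add exp_diff[of "l 0 (t + T) w0"] by (simp add: l_def)
    finally show ?thesis .
  qed
  then have "dynamics M w0 dw P \<sigma> \<mu>"
    unfolding dynamics_iff_nodes[OF assms(2)] by blast
  then show ?thesis
    by blast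
qed

text \<open>The pricing equation at a lattice point reduces to a condition on \<open>q\<close> that is free of the point.
  The initial state therefore already yields the drift condition, with the same \<open>q\<close>.\<close>

lemma no_arbitrage_iff_drift_condition:
  assumes "term_structure M P" and "state_dependent M (state w0 dw) P V"
    and "dynamics M w0 dw P \<sigma> \<mu>"
  shows "no_arbitrage M D (state w0 dw) V \<longleftrightarrow> drift_condition D \<sigma> \<mu>"
proof -
  have start: "node D w0 0 w0"
    by (simp add: node_0)
  have pos: "0 < V 0 T (0, w0)" for T
    using node_price_pos[OF assms(1,2) start] by simp
  let ?v = "\<lambda>t T w. V t T (real t, w)"
  let ?priced = "\<lambda>q T. exp (\<Sum>u<T. \<mu> u) = (\<Sum>s\<in>{0..CARD('n)}. q s * exp (- real T * (\<sigma> \<bullet> D s)))"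
  have pricing: "V t (T + 1) (real t, w) = V t 1 (real t, w) *
      (\<Sum>s\<in>{0..CARD('n)}. q s * V (t + 1) T ((real t, w) + (1, D s))) \<longleftrightarrow> ?priced q T"
    if w: "node D w0 t w" for t w q T
  proof -
    have "V t (T + 1) (real t, w) = V t 1 (real t, w) *
        (\<Sum>s\<in>{0..CARD('n)}. q s * V (t + 1) T (real (t + 1), w + D s)) \<longleftrightarrow> ?priced q T"
      by (rule one_step_pricing_iff[of "\<lambda>T. V 0 T (0, w0)" D w0 ?v, OF pos _ w])
        (use assms(3)[unfolded dynamics_iff_nodes[OF assms(2)]] in blast)
    moreover have "(real t, w) + (1, D s) = (real (t + 1), w + D s)" for s
      by simp
    ultimately show ?thesis
      by presburger
  qed
  \<comment> \<open>No-arbitrage is silent about \<open>T = 0\<close>, where the reduced equation is the total mass of \<open>q\<close>.\<close>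
  have trivial: "?priced q 0" if "positive_prob {0..CARD('n)} q" for q
    using that by (simp add: positive_prob_def)
  show ?thesis
    unfolding drift_condition_iff_exponential
  proof
    assume "no_arbitrage M D (state w0 dw) V"
    then obtain q where q: "positive_prob {0..CARD('n)} q"
      and "\<And>T. T > 0 \<Longrightarrow> V 0 (T + 1) (0, w0) = V 0 1 (0, w0) *
        (\<Sum>s\<in>{0..CARD('n)}. q s * V (0 + 1) T ((0, w0) + (1, D s)))"
      using reachable_start unfolding no_arbitrage_def by blast
    then have "?priced q T" if "T > 0" for T
      using pricing[OF start, of T q] that by simp
    then have "?priced q T" for T
      using trivial[OF q] by (cases "T = 0") auto
    with q show "\<exists>q. positive_prob {0..CARD('n)} q \<and> (\<forall>T. ?priced q T)"
      by blast
  next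
    assume "\<exists>q. positive_prob {0..CARD('n)} q \<and> (\<forall>T. ?priced q T)"
    then obtain q where q: "positive_prob {0..CARD('n)} q" "\<And>T. ?priced q T"
      by blast
    show "no_arbitrage M D (state w0 dw) V"
      unfolding no_arbitrage_def
    proof (intro allI impI)
      fix t i assume "reachable M (state w0 dw) t i"
      then obtain w where w: "node D w0 t w" and i: "i = (real t, w)"
        by (rule reachable_imp_node)
      show "\<exists>q. positive_prob {0..CARD('n)} q \<and> (\<forall>T>0. V t (T + 1) i =
          V t 1 i * (\<Sum>s\<in>{0..CARD('n)}. q s * V (t + 1) T (i + (1, D s))))"
        unfolding i pricing[OF w] using q by blast
    qed
  qed
qed

end

theorem theorem4:
  fixes M :: "'a measure" and p :: "nat pmf" and D :: "nat \<Rightarrow> real ^ 'n"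
    and dw :: "nat \<Rightarrow> 'a \<Rightarrow> real ^ 'n" and w0 :: "real ^ 'n"
    and P :: "nat \<Rightarrow> nat \<Rightarrow> 'a \<Rightarrow> real"
    and V :: "nat \<Rightarrow> nat \<Rightarrow> real \<times> (real ^ 'n) \<Rightarrow> real"
  assumes "prob_space M"
    and "standard_increment p D"
    and "independent_copies M p D dw"
    and "term_structure M P"
    and "state_dependent M (state w0 dw) P V"
    and "stationary M (state w0 dw) P"
  shows "(\<exists>\<sigma> \<mu>. dynamics M w0 dw P \<sigma> \<mu>) \<and>
    (\<forall>\<sigma> \<mu>. dynamics M w0 dw P \<sigma> \<mu> \<longrightarrow>
      (no_arbitrage M D (state w0 dw) V \<longleftrightarrow> drift_condition D \<sigma> \<mu>))"
proof -
  interpret increment_walk M p D dw w0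
    using assms(1-3) by (simp add: increment_walk_def increment_walk_axioms_def)
  show ?thesis
    using ex_dynamics no_arbitrage_iff_drift_condition assms(4-6) by blast
qed

end
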